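(* For all positive integers $n$ and $k$ with $k \geq 3$, there exists an induced subgraph of the Hamming graph $H(n,k)$ with $\alpha(H(n,k))+1$ vertices and maximum degree $1$.
   Context: For a graph $G$, $\alpha(G)$ denotes its independence number. The Hamming graph $H(n,k)$ has vertex set $\{0,1,\dots,k-1\}^n$, two vertices being adjacent if and only if the corresponding vectors differ in exactly one coordinate. *)

theory Defs
  imports "Graph_Theory.Graph_Theory"
begin

text \<open>
  A finite simple graph is a finite, symmetric, loop-free digraph without parallel arcs
  (locale \<open>pair_graph\<close>): an edge \<open>{u, v}\<close> is the pair of arcs \<open>(u, v)\<close>, \<open>(v, u)\<close>.
\<close>

definition independent_set :: "('a, 'b) pre_digraph \<Rightarrow> 'a set \<Rightarrow> bool" where
  "independent_set G S \<longleftrightarrow> S \<subseteq> verts G \<and> (\<forall>u\<in>S. \<forall>v\<in>S. \<not> u \<rightarrow>\<^bsub>G\<^esub> v)"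

text \<open>Meaningful only for finite graphs.\<close>

definition independence_number :: "('a, 'b) pre_digraph \<Rightarrow> nat" where
  "independence_number G = Max {card S | S. independent_set G S}"

text \<open>
  In a simple graph each edge at \<open>v\<close> contributes exactly one arc leaving \<open>v\<close>, so the degree
  is the out-degree. Meaningful only for finite graphs with at least one vertex.
\<close>

definition max_degree :: "('a, 'b) pre_digraph \<Rightarrow> nat" where
  "max_degree G = Max {out_degree G v | v. v \<in> verts G}"

definition hamming_verts :: "nat \<Rightarrow> nat \<Rightarrow> nat list set" where
  "hamming_verts n k = {x. length x = n \<and> set x \<subseteq> {0..<k}}"

definition hamming_graph :: "nat \<Rightarrow> nat \<Rightarrow> nat list pair_pre_digraph" where
  "hamming_graph n k =
     \<lparr> pverts = hamming_verts n k,
       parcs = {(x, y). x \<in> hamming_verts n k \<and> y \<in> hamming_verts n k \<and>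
                        card {i. i < n \<and> x ! i \<noteq> y ! i} = 1} \<rparr>"

lemma finite_hamming_verts: "finite (hamming_verts n k)"
  using finite_lists_length_eq[of "{0..<k}" n]
  by (simp add: hamming_verts_def conj_commute)

lemma pair_graph_hamming_graph: "pair_graph (hamming_graph n k)"
proof
  show "finite (parcs (hamming_graph n k))"
    by (rule finite_subset[of _ "hamming_verts n k \<times> hamming_verts n k"])
      (auto simp: hamming_graph_def finite_hamming_verts)
  show "symmetric (with_proj (hamming_graph n k))"
    by (auto simp: symmetric_def hamming_graph_def intro!: symI simp: eq_commute)
qed (auto simp: hamming_graph_def finite_hamming_verts)

end

theory Submission
  imports Defs "HOL-Number_Theory.Cong"
begin

text \<open>
  Colour a vertex by its coordinate sum modulo \<open>k\<close>; every colour class is an independent set of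
  the maximal size \<open>k ^ (n - 1)\<close>. By induction on \<open>n\<close> there is a set \<open>S\<close> of \<open>k ^ (n - 1) + 1\<close>
  vertices of maximum degree at most 1 that uses only the colours 0 and 1. In dimension \<open>n + 1\<close>,
  put \<open>S\<close> into layer 0, colour class \<open>k - 1\<close> into layer 1, and colour class \<open>k + 1 - a\<close> into
  each layer \<open>a \<ge> 2\<close>. Only layers 1 and 2 share vertices, where they form a perfect matching, and
  the new vertices outside layer 0 again have colour 0 (layer 1) or 1 (layers \<open>a \<ge> 2\<close>).
\<close>

section \<open>Hamming adjacency and colours\<close>

text \<open>Reading the dimension off as \<open>length x\<close> keeps the relation free of a
  parameter, so that inductions can peel off one coordinate at a time.\<close>

definition hamming_adj :: "nat list \<Rightarrow> nat list \<Rightarrow> bool" where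
  "hamming_adj x y \<longleftrightarrow> card {i. i < length x \<and> x ! i \<noteq> y ! i} = 1"

definition colour_class :: "nat \<Rightarrow> nat \<Rightarrow> nat \<Rightarrow> nat list set" where
  "colour_class n k c = {x \<in> hamming_verts n k. sum_list x mod k = c}"

text \<open>Maximum degree at most 1 in the subgraph induced on \<open>S\<close>, phrased without
  counting neighbours.\<close>

definition matching_like :: "nat list set \<Rightarrow> bool" where
  "matching_like S \<longleftrightarrow>
     (\<forall>x\<in>S. \<forall>y\<in>S. \<forall>z\<in>S. hamming_adj x y \<longrightarrow> hamming_adj x z \<longrightarrow> y = z)"

lemma hamming_verts_Suc:
  "x \<in> hamming_verts (Suc n) k \<longleftrightarrow> (\<exists>a u. x = a # u \<and> a < k \<and> u \<in> hamming_verts n k)"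
  by (cases x) (auto simp: hamming_verts_def)

lemma card_hamming_verts: "card (hamming_verts n k) = k ^ n"
  using card_lists_length_eq[of "{0..<k}" n] by (simp add: hamming_verts_def conj_commute)

lemma hamming_adj_refl: "\<not> hamming_adj x x"
  by (simp add: hamming_adj_def)

lemma hamming_adj_Cons:
  assumes "length u = length v"
  shows "hamming_adj (a # u) (b # v) \<longleftrightarrow> a = b \<and> hamming_adj u v \<or> a \<noteq> b \<and> u = v"
proof -
  let ?D = "{i. i < length u \<and> u ! i \<noteq> v ! i}"
  have split: "{i. i < length (a # u) \<and> (a # u) ! i \<noteq> (b # v) ! i}
      = (if a = b then {} else {0}) \<union> Suc ` ?D"
  proof (rule set_eqI)
    fix i
    show "i \<in> {i. i < length (a # u) \<and> (a # u) ! i \<noteq> (b # v) ! i}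
      \<longleftrightarrow> i \<in> (if a = b then {} else {0}) \<union> Suc ` ?D"
      by (cases i) auto
  qed
  have card_Suc: "card (Suc ` ?D) = card ?D"
    by (simp add: card_image)
  have empty: "?D = {} \<longleftrightarrow> u = v"
    using assms by (auto simp: list_eq_iff_nth_eq)
  show ?thesis
  proof (cases "a = b")
    case True
    then show ?thesis
      unfolding hamming_adj_def split by (simp add: card_Suc)
  next
    case False
    have "card ({0} \<union> Suc ` ?D) = Suc (card ?D)"
      by (subst card_Un_disjoint) (auto simp: card_Suc)
    moreover have "card ?D = 0 \<longleftrightarrow> ?D = {}"
      by (subst card_0_eq) auto
    ultimately show ?thesis
      unfolding hamming_adj_def split using False empty by simp
  qed
qed

text \<open>Changing one coordinate changes the sum by a difference of two distinct numbers below
  \<open>k\<close>, which is nonzero modulo \<open>k\<close>.\<close>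

lemma hamming_adj_colour_neq:
  assumes "x \<in> hamming_verts n k" "y \<in> hamming_verts n k" "hamming_adj x y"
  shows "sum_list x mod k \<noteq> sum_list y mod k"
  using assms
proof (induction n arbitrary: x y)
  case 0
  then show ?case by (simp add: hamming_verts_def hamming_adj_def)
next
  case (Suc n)
  then obtain a u b v where xy: "x = a # u" "a < k" "u \<in> hamming_verts n k"
      "y = b # v" "b < k" "v \<in> hamming_verts n k"
    by (auto simp: hamming_verts_Suc)
  then have "length u = length v"
    by (simp add: hamming_verts_def)
  with Suc.prems(3) xy consider "a = b" "hamming_adj u v" | "a \<noteq> b" "u = v"
    by (auto simp: hamming_adj_Cons)
  then show ?case
  proof cases
    case 1
    with Suc.IH xy have "\<not> [sum_list u = sum_list v] (mod k)"
      by (auto simp: cong_def)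
    with 1 xy show ?thesis
      by (auto simp: cong_def[symmetric] cong_add_lcancel_nat)
  next
    case 2
    with xy have "\<not> [a = b] (mod k)"
      by (simp add: cong_def)
    with 2 xy show ?thesis
      by (auto simp: cong_def[symmetric] cong_add_rcancel_nat)
  qed
qed

section \<open>Sizes of colour classes\<close>

lemma mod_if_less_double:
  fixes x k :: nat
  assumes "x < 2 * k"
  shows "x mod k = (if x < k then x else x - k)"
  using assms by (simp add: le_mod_geq)

text \<open>The last \<open>n\<close> coordinates are free, and the first is then determined by the
  colour.\<close>

lemma card_colour_class:
  assumes "c < k"
  shows "card (colour_class (Suc n) k c) = k ^ n"
proof -
  \<comment> \<open>The forced first coordinate, \<open>c\<close> minus the sum of the tail modulo
    \<open>k\<close>; going through \<open>k - ...\<close> avoids truncated subtraction.\<close>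
  let ?d = "\<lambda>u. (c + (k - sum_list u mod k)) mod k"
  have d_iff: "?d u = a \<longleftrightarrow> (a + sum_list u) mod k = c" if "a < k" for a u
  proof -
    define s where "s = sum_list u mod k"
    have s: "s < k" using assms by (simp add: s_def)
    have "(a + sum_list u) mod k = (a + s) mod k" by (simp add: s_def mod_add_right_eq)
    also have "\<dots> = (if a + s < k then a + s else a + s - k)"
      using s that by (intro mod_if_less_double) linarith
    finally have 1: "(a + sum_list u) mod k = \<dots>" .
    show ?thesis
    proof (cases "s \<le> c")
      case True
      then have "?d u = c - s"
        using s assms by (simp add: s_def[symmetric] mod_if_less_double)
      with True 1 s that assms show ?thesis by (auto simp: s_def[symmetric])
    next
      case False
      then have "?d u = c + k - s"
        using s assms by (simp add: s_def[symmetric])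
      with False 1 s that assms show ?thesis by (auto simp: s_def[symmetric])
    qed
  qed
  have "x \<in> colour_class (Suc n) k c \<longleftrightarrow> x \<in> (\<lambda>u. ?d u # u) ` hamming_verts n k" for x
  proof -
    have "x \<in> colour_class (Suc n) k c \<longleftrightarrow>
        (\<exists>a u. x = a # u \<and> a < k \<and> u \<in> hamming_verts n k \<and> (a + sum_list u) mod k = c)"
      unfolding colour_class_def by (auto simp: hamming_verts_Suc)
    also have "\<dots> \<longleftrightarrow> (\<exists>a u. x = a # u \<and> a < k \<and> u \<in> hamming_verts n k \<and> ?d u = a)"
      using d_iff by blast
    also have "\<dots> \<longleftrightarrow> (\<exists>u \<in> hamming_verts n k. x = ?d u # u)"
      using assms by auto
    finally show ?thesis by (simp add: image_iff)
  qed
  then have "colour_class (Suc n) k c = (\<lambda>u. ?d u # u) ` hamming_verts n k"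
    by blast
  moreover have "inj_on (\<lambda>u. ?d u # u) (hamming_verts n k)"
    by (auto intro: inj_onI)
  ultimately show ?thesis
    by (simp add: card_image card_hamming_verts)
qed

section \<open>Inductive construction of the large set\<close>

text \<open>The colour bound strengthens the induction: it keeps layer 0 disjoint from all other
  layers, whose colours are at least 2.\<close>

lemma exists_matching_like_set:
  assumes "k \<ge> 3"
  shows "\<exists>S \<subseteq> hamming_verts (Suc n) k. card S = k ^ n + 1 \<and> matching_like S \<and>
           (\<forall>x\<in>S. sum_list x mod k \<le> 1)"
proof (induction n)
  case 0
  have "{[0], [1]} \<subseteq> hamming_verts (Suc 0) k"
    using assms by (auto simp: hamming_verts_def)
  moreover have "matching_like {[0], [1]}"
    by (auto simp: matching_like_def hamming_adj_refl)
  ultimately show ?case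
    using assms by (intro exI[of _ "{[0], [1]}"]) auto
next
  case (Suc n)
  then obtain S where S: "S \<subseteq> hamming_verts (Suc n) k" "card S = k ^ n + 1" "matching_like S"
      "\<And>x. x \<in> S \<Longrightarrow> sum_list x mod k \<le> 1"
    by blast
  define col where "col a = (if a = 1 then k - 1 else k + 1 - a)" for a
  define L where "L a = (if a = 0 then S else colour_class (Suc n) k (col a))" for a
  define T where "T = (\<Union>a<k. (#) a ` L a)"
  \<comment> \<open>For layer 1 the lower bound amounts to k \<ge> 3.\<close>
  have col: "col a < k" "2 \<le> col a" if "a \<noteq> 0" "a < k" for a
    using that assms by (auto simp: col_def)
  have L_verts: "L a \<subseteq> hamming_verts (Suc n) k" for a
    using S(1) by (auto simp: L_def colour_class_def)
  have L_colour: "sum_list u mod k = col a" if "u \<in> L a" "a \<noteq> 0" for a u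
    using that by (auto simp: L_def colour_class_def)
  have T_verts: "T \<subseteq> hamming_verts (Suc (Suc n)) k"
    unfolding T_def using L_verts by (force simp: hamming_verts_Suc[of _ "Suc n"])
  have finite_L: "finite (L a)" for a
    using L_verts finite_hamming_verts finite_subset by blast
  have "card T = (\<Sum>a<k. card ((#) a ` L a))"
    unfolding T_def using finite_L by (intro card_UN_disjoint) auto
  also have "\<dots> = (\<Sum>a<k. card (L a))"
    by (simp add: card_image)
  \<comment> \<open>The surplus vertex comes from layer 0; the other k - 1 layers contribute
    \<open>k ^ n\<close> each.\<close>
  also have "\<dots> = card (L 0) + (\<Sum>a\<in>{..<k} - {0}. card (L a))"
    using assms by (intro sum.remove) auto
  also have "(\<Sum>a\<in>{..<k} - {0}. card (L a)) = (\<Sum>a\<in>{..<k} - {0}. k ^ n)"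
    using col by (intro sum.cong) (auto simp: L_def card_colour_class)
  also have "card (L 0) + \<dots> = k ^ Suc n + 1"
    using assms S(2) by (cases k) (auto simp: L_def)
  finally have card_T: "card T = k ^ Suc n + 1" .
  have T_colour: "sum_list x mod k \<le> 1" if "x \<in> T" for x
  proof -
    from that obtain a u where x: "x = a # u" "a < k" "u \<in> L a"
      by (auto simp: T_def)
    show ?thesis
    proof (cases "a = 0")
      case True
      with x S(4) show ?thesis by (simp add: L_def)
    next
      case False
      with x have "sum_list x mod k = (a + col a) mod k"
        using L_colour[of u a] by (metis mod_add_right_eq sum_list.Cons)
      also have "a + col a = k \<or> a + col a = k + 1"
        using x assms by (auto simp: col_def)
      then have "(a + col a) mod k \<le> 1"
        using assms by (elim disjE) (simp_all add: mod_if_less_double)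
      finally show ?thesis .
    qed
  qed
  have shared: "a = 1 \<and> b = 2 \<or> a = 2 \<and> b = 1"
    if "u \<in> L a" "u \<in> L b" "a \<noteq> b" "a < k" "b < k" for a b u
  proof -
    \<comment> \<open>A vertex of layer 0 has colour at most 1, so it cannot lie in another
      layer.\<close>
    have "c \<noteq> 0" if "u \<in> L c" "u \<in> L d" "c \<noteq> d" "d < k" for c d
    proof
      assume "c = 0"
      with that have "sum_list u mod k \<le> 1" "d \<noteq> 0"
        using S(4) by (auto simp: L_def)
      with that col(2)[of d] L_colour[of u d] show False by simp
    qed
    with that have "a \<noteq> 0" "b \<noteq> 0" by metis+
    then have "col a = col b"
      using L_colour that by metis
    with that \<open>a \<noteq> 0\<close> \<open>b \<noteq> 0\<close> show ?thesis
      by (auto simp: col_def split: if_splits)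
  qed
  \<comment> \<open>An edge inside a layer forces layer 0, since colour classes are independent; an
    edge between layers joins two copies of a shared vertex.\<close>
  have adj: "a = 0 \<and> b = 0 \<and> hamming_adj u v \<or> u = v \<and> (a = 1 \<and> b = 2 \<or> a = 2 \<and> b = 1)"
    if "u \<in> L a" "v \<in> L b" "a < k" "b < k" "hamming_adj (a # u) (b # v)" for a b u v
  proof -
    have uv: "u \<in> hamming_verts (Suc n) k" "v \<in> hamming_verts (Suc n) k"
      using that L_verts by blast+
    then have "length u = length v"
      by (simp add: hamming_verts_def)
    with that consider "a = b" "hamming_adj u v" | "a \<noteq> b" "u = v"
      by (auto simp: hamming_adj_Cons)
    then show ?thesis
    proof cases
      case 1
      then have "a = 0"
        using hamming_adj_colour_neq[OF uv] L_colour that by metis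
      with 1 show ?thesis by simp
    next
      case 2
      with that shared show ?thesis by blast
    qed
  qed
  have "matching_like T"
    unfolding matching_like_def
  proof (intro ballI impI)
    fix x y z
    assume "x \<in> T" "y \<in> T" "z \<in> T" and xyz: "hamming_adj x y" "hamming_adj x z"
    then obtain a u b v c w where *: "x = a # u" "a < k" "u \<in> L a"
        "y = b # v" "b < k" "v \<in> L b" "z = c # w" "c < k" "w \<in> L c"
      unfolding T_def by blast
    \<comment> \<open>In layer 0 this is the induction hypothesis; from layer 1 or 2 the only
      possible neighbour is the copy of the same tail in the other of the two.\<close>
    show "y = z"
      using adj[of u a v b] adj[of u a w c] * xyz S(3)
      by (auto simp: L_def matching_like_def)
  qed
  with T_verts card_T T_colour show ?case by blast
qed

section \<open>Independence number and the induced subgraph\<close>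

lemma dominates_hamming_graph:
  "x \<rightarrow>\<^bsub>with_proj (hamming_graph n k)\<^esub> y \<longleftrightarrow>
     x \<in> hamming_verts n k \<and> y \<in> hamming_verts n k \<and> hamming_adj x y"
  by (auto simp: hamming_graph_def hamming_adj_def hamming_verts_def)

text \<open>Vertices with a common tail form a clique, so an independent set contains at most one
  vertex for each of the \<open>k ^ n\<close> tails.\<close>

lemma independent_set_card_le:
  assumes "independent_set (with_proj (hamming_graph (Suc n) k)) S"
  shows "card S \<le> k ^ n"
proof -
  have S: "S \<subseteq> hamming_verts (Suc n) k"
    using assms by (simp add: independent_set_def hamming_graph_def)
  have "inj_on tl S"
  proof (rule inj_onI)
    fix x y
    assume xy: "x \<in> S" "y \<in> S" "tl x = tl y"
    then have "x \<in> hamming_verts (Suc n) k" "y \<in> hamming_verts (Suc n) k"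
      using S by blast+
    with xy(3) obtain a u b where *: "x = a # u" "y = b # u"
      by (auto simp: hamming_verts_Suc)
    have "\<not> hamming_adj x y"
      using assms xy S unfolding independent_set_def dominates_hamming_graph by blast
    with * show "x = y"
      by (simp add: hamming_adj_Cons)
  qed
  moreover have "tl ` S \<subseteq> hamming_verts n k"
    using S by (fastforce simp: hamming_verts_Suc)
  ultimately have "card S \<le> card (hamming_verts n k)"
    using card_inj_on_le finite_hamming_verts by blast
  then show ?thesis
    by (simp add: card_hamming_verts)
qed

lemma independent_set_colour_class:
  "independent_set (with_proj (hamming_graph n k)) (colour_class n k c)"
  unfolding independent_set_def dominates_hamming_graph
  using hamming_adj_colour_neq
  by (fastforce simp: colour_class_def hamming_graph_def)

lemma independence_number_hamming_graph:
  assumes "k > 0"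
  shows "independence_number (with_proj (hamming_graph (Suc n) k)) = k ^ n"
  unfolding independence_number_def
proof (rule Max_eqI)
  show "finite {card S |S. independent_set (with_proj (hamming_graph (Suc n) k)) S}"
    by (rule finite_subset[of _ "{..k ^ n}"]) (auto intro: independent_set_card_le)
  \<comment> \<open>Attained by colour class 0.\<close>
  show "k ^ n \<in> {card S |S. independent_set (with_proj (hamming_graph (Suc n) k)) S}"
    using independent_set_colour_class card_colour_class[OF assms]
    by (metis (mono_tags) mem_Collect_eq)
qed (auto intro: independent_set_card_le)

theorem theorem1:
  fixes n k :: nat
  assumes "n \<ge> 1" and "k \<ge> 3"
  shows "\<exists>H. induced_subgraph H (with_proj (hamming_graph n k)) \<and>
             card (verts H) = independence_number (with_proj (hamming_graph n k)) + 1 \<and>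
             max_degree H = 1"
proof -
  obtain m where n: "n = Suc m"
    using assms(1) by (cases n) auto
  let ?G = "with_proj (hamming_graph n k)"
  interpret pair_graph "hamming_graph n k"
    by (rule pair_graph_hamming_graph)
  obtain S where S: "S \<subseteq> hamming_verts n k" "card S = k ^ m + 1" "matching_like S"
    using exists_matching_like_set[OF assms(2), of m] n by blast
  let ?H = "?G \<restriction> S"
  have finite_S: "finite S"
    using S(1) finite_hamming_verts finite_subset by blast
  have degree: "out_degree ?H x = card {y \<in> S. hamming_adj x y}" if "x \<in> S" for x
  proof -
    have "out_arcs ?H x = Pair x ` {y \<in> S. hamming_adj x y}"
      using that S(1)
      by (auto simp: out_arcs_def induce_subgraph_def hamming_graph_def hamming_adj_def
          hamming_verts_def)
    then show ?thesis
      by (simp add: out_degree_def card_image inj_on_def)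
  qed
  have degree_le: "out_degree ?H x \<le> 1" if "x \<in> S" for x
    using that S(3) finite_S unfolding degree[OF that] matching_like_def
    by (subst One_nat_def, subst card_le_Suc0_iff_eq) auto
  \<comment> \<open>Being larger than any independent set, \<open>S\<close> spans an edge, so the
    maximum degree is exactly 1 and not 0.\<close>
  have "\<not> independent_set ?G S"
    using independent_set_card_le[of m k S] S(2) n by auto
  then obtain x y where xy: "x \<in> S" "y \<in> S" "hamming_adj x y"
    using S(1) unfolding independent_set_def dominates_hamming_graph
    by (auto simp: hamming_graph_def)
  then have "out_degree ?H x > 0"
    using finite_S by (auto simp: degree card_gt_0_iff)
  with degree_le[OF xy(1)] have degree_x: "out_degree ?H x = 1"
    by simp
  have "max_degree ?H = 1"
    unfolding max_degree_def
  proof (rule Max_eqI)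
    show "finite {out_degree ?H v |v. v \<in> verts ?H}"
      using finite_S by simp
    show "1 \<in> {out_degree ?H v |v. v \<in> verts ?H}"
      using degree_x xy(1) by force
  qed (use degree_le in auto)
  moreover have "induced_subgraph ?H ?G"
    using S(1) by (intro induced_induce) (auto simp: hamming_graph_def)
  moreover have "card (verts ?H) = independence_number ?G + 1"
    using S(2) assms(2) n by (simp add: independence_number_hamming_graph)
  ultimately show ?thesis by blast
qed

end
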